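(* Let $X\in\mathbb{R}^{n\times p}$ with $X^{\mathsf T}X=I_p$, let $\tau\ge0$, and let $D\in\mathbb{R}^{n\times p}$ satisfy $X^{\mathsf T}D+D^{\mathsf T}X=0$ and be such that $I_p+\frac{\tau}{4}X^{\mathsf T}D$ is invertible. Then the Wen–Yin update scheme $$Y_{\mathrm{wy}}(\tau;X)=X-\tau U\Big(I_{2p}+\frac{\tau}{2}V^{\mathsf T}U\Big)^{-1}V^{\mathsf T}X,\qquad U=[P_XD,\ X],\quad V=[X,\ -P_XD]\in\mathbb{R}^{n\times 2p},$$ is well defined (i.e. $I_{2p}+\frac{\tau}{2}V^{\mathsf T}U$ is invertible), and it is equivalent to the update scheme $$W=-(I_n-XX^{\mathsf T})D,\quad J(\tau)=I_p+\tfrac{\tau^2}{4}W^{\mathsf T}W+\tfrac{\tau}{2}X^{\mathsf T}D,\quad Y(\tau;X)=(2X+\tau W)J(\tau)^{-1}-X,$$ that is, $Y_{\mathrm{wy}}(\tau;X)=Y(\tau;X)$.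
   Context: Here $1\le p\le n$ and $P_X=I_n-\frac12XX^{\mathsf T}$. $[A,\ B]$ denotes the horizontal concatenation of two $n\times p$ matrices. *)

theory Defs
  imports "HOL-Analysis.Analysis"
begin

text \<open>
  An \<open>n \<times> p\<close> matrix has type \<^typ>\<open>real^'p^'n\<close> (rows indexed by \<open>'n\<close>), and the sum type
  \<open>'p + 'p\<close> is the index type of size \<open>2p\<close>.
\<close>

definition hconcat :: "real^'p^'n \<Rightarrow> real^'q^'n \<Rightarrow> real^('p + 'q)^'n" where
  "hconcat A B = (\<chi> i j. case j of Inl k \<Rightarrow> A $ i $ k | Inr k \<Rightarrow> B $ i $ k)"

definition P_mat :: "real^'p^'n \<Rightarrow> real^'n^'n" where
  "P_mat X = mat 1 - (1/2) *\<^sub>R (X ** transpose X)"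

definition wy_U :: "real^'p^'n \<Rightarrow> real^'p^'n \<Rightarrow> real^('p + 'p)^'n" where
  "wy_U X D = hconcat (P_mat X ** D) X"

definition wy_V :: "real^'p^'n \<Rightarrow> real^'p^'n \<Rightarrow> real^('p + 'p)^'n" where
  "wy_V X D = hconcat X (- (P_mat X ** D))"

definition wy_M :: "real^'p^'n \<Rightarrow> real^'p^'n \<Rightarrow> real \<Rightarrow> real^('p + 'p)^('p + 'p)" where
  "wy_M X D \<tau> = mat 1 + (\<tau>/2) *\<^sub>R (transpose (wy_V X D) ** wy_U X D)"

text \<open>
  \<^const>\<open>matrix_inv\<close> is unspecified on singular matrices, so the two schemes below are
  meaningful only when \<open>wy_M X D \<tau>\<close>, respectively \<open>J_mat X D \<tau>\<close>, is invertible.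
\<close>

definition Y_wy :: "real^'p^'n \<Rightarrow> real^'p^'n \<Rightarrow> real \<Rightarrow> real^'p^'n" where
  "Y_wy X D \<tau> =
     X - \<tau> *\<^sub>R (wy_U X D ** matrix_inv (wy_M X D \<tau>) ** transpose (wy_V X D) ** X)"

definition W_mat :: "real^'p^'n \<Rightarrow> real^'p^'n \<Rightarrow> real^'p^'n" where
  "W_mat X D = - ((mat 1 - X ** transpose X) ** D)"

definition J_mat :: "real^'p^'n \<Rightarrow> real^'p^'n \<Rightarrow> real \<Rightarrow> real^'p^'p" where
  "J_mat X D \<tau> = mat 1 + (\<tau>\<^sup>2/4) *\<^sub>R (transpose (W_mat X D) ** W_mat X D)
                       + (\<tau>/2) *\<^sub>R (transpose X ** D)"

definition Y_update :: "real^'p^'n \<Rightarrow> real^'p^'n \<Rightarrow> real \<Rightarrow> real^'p^'n" where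
  "Y_update X D \<tau> = (2 *\<^sub>R X + \<tau> *\<^sub>R W_mat X D) ** matrix_inv (J_mat X D \<tau>) - X"

end

theory Submission
  imports Defs
begin

text \<open>
  Put \<open>A = X\<^sup>T D\<close> (skew-symmetric), \<open>E = P\<^sub>X D\<close> and \<open>G = I + (\<tau>/4) A\<close>. Then \<open>X\<^sup>T E = A/2\<close>, so
  \<open>I + (\<tau>/2) V\<^sup>T U\<close> has the blocks \<open>G\<close>, \<open>(\<tau>/2) I\<close>, \<open>-(\<tau>/2) E\<^sup>T E\<close>, \<open>G\<close>, and
  \<open>J = G\<^sup>2 + (\<tau>\<^sup>2/4) E\<^sup>T E\<close> is what remains after eliminating the second
  unknown with the first row. The symmetric part of \<open>J\<close> is
  \<open>I + (\<tau>\<^sup>2/4) W\<^sup>T W\<close>, whence \<open>J\<close> is invertible, and with \<open>G\<close> so is the block matrix.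
  The system with right-hand side \<open>V\<^sup>T X = (I; A/2)\<close> has the solution
  \<open>(S; T)\<close> with \<open>S = J\<^sup>-\<^sup>1\<close> and \<open>\<tau> T = 2 (I - G S)\<close>, and \<open>2 X G - \<tau> E = 2 X + \<tau> W\<close>.
\<close>

section \<open>Ring and transpose laws for rectangular matrices\<close>

lemma matrix_mult_minus_left: "(- A) ** B = - (A ** B)"
  for A :: "real^'m^'n" and B :: "real^'k^'m"
  by (simp add: matrix_matrix_mult_def vec_eq_iff sum_negf)

lemma matrix_mult_minus_right: "A ** (- B) = - (A ** B)"
  for A :: "real^'m^'n" and B :: "real^'k^'m"
  by (simp add: matrix_matrix_mult_def vec_eq_iff sum_negf)

lemma matrix_mult_zero_right: "A ** 0 = 0"
  for A :: "real^'m^'n"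
  by (simp add: matrix_matrix_mult_def vec_eq_iff)

lemma matrix_add_rdistrib: "(A + B) ** C = A ** C + B ** C"
  for A B :: "real^'m^'n" and C :: "real^'k^'m"
  by (simp add: matrix_matrix_mult_def vec_eq_iff sum.distrib distrib_right)

lemma matrix_diff_ldistrib: "A ** (B - C) = A ** B - A ** C"
  for A :: "real^'m^'n" and B C :: "real^'k^'m"
  by (simp add: matrix_matrix_mult_def vec_eq_iff sum_subtractf right_diff_distrib)

lemma matrix_diff_rdistrib: "(A - B) ** C = A ** C - B ** C"
  for A B :: "real^'m^'n" and C :: "real^'k^'m"
  by (simp add: matrix_matrix_mult_def vec_eq_iff sum_subtractf left_diff_distrib)

lemma transpose_add: "transpose (A + B) = transpose A + transpose B"
  for A B :: "real^'m^'n"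
  by (simp add: transpose_def vec_eq_iff)

lemma transpose_diff: "transpose (A - B) = transpose A - transpose B"
  for A B :: "real^'m^'n"
  by (simp add: transpose_def vec_eq_iff)

lemma transpose_uminus: "transpose (- A) = - transpose A"
  for A :: "real^'m^'n"
  by (simp add: transpose_def vec_eq_iff)

lemmas matrix_ring_simps =
  matrix_mult_minus_left matrix_mult_minus_right matrix_add_ldistrib matrix_add_rdistrib
  matrix_diff_ldistrib matrix_diff_rdistrib matrix_scalar_ac scalar_matrix_assoc[symmetric]
  matrix_mul_assoc transpose_add transpose_diff transpose_uminus transpose_scalar
  matrix_transpose_mul

section \<open>Criteria for invertibility\<close>

lemma invertible_ker: "invertible A \<longleftrightarrow> (\<forall>x. A *v x = 0 \<longrightarrow> x = 0)"
  for A :: "real^'n^'n"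
  by (simp add: invertible_left_inverse matrix_left_invertible_ker)

lemma matrix_inv_mult_eq:
  fixes A :: "real^'n^'n" and B :: "real^'m^'n"
  assumes "invertible A"
  shows "A ** (matrix_inv A ** B) = B" and "matrix_inv A ** (A ** B) = B"
proof -
  have "A ** matrix_inv A = mat 1 \<and> matrix_inv A ** A = mat 1"
    using assms unfolding invertible_def matrix_inv_def by (rule someI_ex)
  then show "A ** (matrix_inv A ** B) = B" and "matrix_inv A ** (A ** B) = B"
    by (simp_all add: matrix_mul_assoc)
qed

text \<open>A kernel vector repeated in every column gives a matrix \<open>Z\<close> with
  \<open>A ** Z = 0\<close>. This lets the kernel test be run on matrix unknowns, for which the
  block rules of \<open>vconcat\<close> are stated.\<close>

lemma invertible_if_mult_zero:
  fixes A :: "real^'n^'n"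
  assumes "\<And>Z :: real^'n^'n. A ** Z = 0 \<Longrightarrow> Z = 0"
  shows "invertible A"
  unfolding invertible_ker
proof (intro allI impI)
  fix x assume "A *v x = 0"
  then have "A ** (\<chi> i j. x $ i) = 0"
    by (simp add: matrix_matrix_mult_def matrix_vector_mult_def vec_eq_iff)
  from assms[OF this] show "x = 0"
    by (simp add: vec_eq_iff)
qed

lemma inner_transpose_mult_vec: "x \<bullet> (transpose A *v y) = (A *v x) \<bullet> y"
  for A :: "real^'m^'n"
  by (metis dot_lmul_matrix inner_commute transpose_matrix_vector)

lemma inner_skew_mult_vec:
  fixes A :: "real^'n^'n"
  assumes "transpose A = - A"
  shows "x \<bullet> (A *v x) = 0"
proof -
  have "x \<bullet> (A *v x) = - (x \<bullet> (transpose A *v x))"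
    by (simp add: assms matrix_vector_mult_def inner_vec_def sum_negf del: transpose_matrix_vector)
  also have "\<dots> = - (x \<bullet> (A *v x))"
    by (simp only: inner_transpose_mult_vec inner_commute)
  finally show ?thesis by simp
qed

text \<open>Pairing the kernel equation with \<open>x\<close> kills the skew term and leaves a sum
  of two nonnegative terms, one of them \<open>x \<bullet> x\<close>.\<close>

lemma invertible_skew_perturbation:
  fixes A :: "real^'n^'n" and W :: "real^'n^'m"
  assumes "transpose A = - A" and "0 \<le> c"
  shows "invertible (mat 1 + c *\<^sub>R (transpose W ** W) + d *\<^sub>R A)"
  unfolding invertible_ker
proof (intro allI impI)
  fix x assume *: "(mat 1 + c *\<^sub>R (transpose W ** W) + d *\<^sub>R A) *v x = 0"
  have "0 = x \<bullet> ((mat 1 + c *\<^sub>R (transpose W ** W) + d *\<^sub>R A) *v x)"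
    by (simp add: *)
  also have "\<dots> = x \<bullet> x + c * (x \<bullet> (transpose W *v (W *v x))) + d * (x \<bullet> (A *v x))"
    by (simp add: matrix_vector_mult_add_rdistrib inner_add_right matrix_vector_mul_assoc
        scaleR_matrix_vector_assoc[symmetric] del: transpose_matrix_vector)
  also have "\<dots> = x \<bullet> x + c * ((W *v x) \<bullet> (W *v x))"
    by (simp only: inner_skew_mult_vec[OF assms(1)] inner_transpose_mult_vec mult_zero_right add_0_right)
  finally have "x \<bullet> x \<le> 0"
    using assms(2) by (smt (verit) inner_ge_zero mult_nonneg_nonneg)
  then show "x = 0" by (metis inner_gt_zero_iff not_le)
qed

section \<open>Stacked blocks over a sum index type\<close>

definition vconcat :: "real^'k^'p \<Rightarrow> real^'k^'q \<Rightarrow> real^'k^('p + 'q)" where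
  "vconcat A B = (\<chi> i. case i of Inl k \<Rightarrow> A $ k | Inr k \<Rightarrow> B $ k)"

lemma vconcat_inject: "vconcat A B = vconcat C D \<longleftrightarrow> A = C \<and> B = D"
  by (auto simp: vconcat_def vec_eq_iff split_sum_all)

lemma vconcat_cases:
  obtains S T where "Z = vconcat S T"
proof
  show "Z = vconcat (\<chi> k. Z $ Inl k) (\<chi> k. Z $ Inr k)"
    by (auto simp: vconcat_def vec_eq_iff split_sum_all)
qed

lemma vconcat_zero: "vconcat 0 0 = 0"
  by (auto simp: vconcat_def vec_eq_iff split_sum_all)

lemma vconcat_add: "vconcat A B + vconcat C D = vconcat (A + C) (B + D)"
  by (auto simp: vconcat_def vec_eq_iff split_sum_all)

lemma vconcat_scaleR: "c *\<^sub>R vconcat A B = vconcat (c *\<^sub>R A) (c *\<^sub>R B)"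
  by (auto simp: vconcat_def vec_eq_iff split_sum_all)

lemma vconcat_mult: "vconcat A B ** C = vconcat (A ** C) (B ** C)"
  by (auto simp: vconcat_def vec_eq_iff split_sum_all matrix_matrix_mult_def)

lemma hconcat_mult_vconcat: "hconcat A B ** vconcat S T = A ** S + B ** T"
  by (simp add: hconcat_def vconcat_def vec_eq_iff matrix_matrix_mult_def sum.Plus
      flip: UNIV_Plus_UNIV)

lemma transpose_hconcat: "transpose (hconcat A B) = vconcat (transpose A) (transpose B)"
  by (auto simp: hconcat_def vconcat_def vec_eq_iff split_sum_all transpose_def)

section \<open>Algebra of a tangent direction at a point with orthonormal columns\<close>

locale stiefel_direction =
  fixes X D :: "real^'p^'n"
  assumes orth: "transpose X ** X = mat 1"
    and tangent: "transpose X ** D + transpose D ** X = 0"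
begin

definition "A = transpose X ** D"

definition "E = P_mat X ** D"

definition "G t = mat 1 + (t / 4) *\<^sub>R A"

lemma DX: "transpose D ** X = - A"
  using tangent by (simp add: A_def add_eq_0_iff)

text \<open>Simplification associates products to the left, so \<open>transpose X ** X\<close>
  inside a longer product shows up only behind a prefix \<open>K\<close>.\<close>

lemma orth_mult: "K ** transpose X ** X = K" for K :: "real^'p^'k"
  by (simp add: orth flip: matrix_mul_assoc)

lemma XD_mult: "K ** transpose X ** D = K ** A" for K :: "real^'p^'k"
  by (simp add: A_def flip: matrix_mul_assoc)

lemma transpose_A: "transpose A = - A"
  using DX by (simp add: A_def matrix_transpose_mul)

lemma E_eq: "E = D - (1/2) *\<^sub>R (X ** A)"
  by (simp add: E_def P_mat_def A_def matrix_ring_simps)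

lemma W_eq: "W_mat X D = X ** A - D"
  by (simp add: W_mat_def A_def matrix_ring_simps)

lemmas reduce = matrix_ring_simps orth orth_mult DX XD_mult A_def[symmetric] transpose_A

lemma XE: "transpose X ** E = (1/2) *\<^sub>R A"
  by (simp add: E_eq reduce)

lemma EX: "transpose E ** X = - ((1/2) *\<^sub>R A)"
  using arg_cong[OF XE, of transpose] by (simp add: matrix_ring_simps transpose_A)

lemma EE: "transpose E ** E = transpose D ** D + (3/4) *\<^sub>R (A ** A)"
  by (simp add: E_eq reduce) (simp add: vec_eq_iff field_simps)

text \<open>\<open>W\<^sup>T W\<close> exceeds \<open>E\<^sup>T E\<close> by
  \<open>A\<^sup>2/4\<close>, exactly what completes \<open>I + (t/2) A\<close> to the square of
  \<open>G t\<close>.\<close>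

lemma J_eq: "J_mat X D t = G t ** G t + (t\<^sup>2/4) *\<^sub>R (transpose E ** E)"
  by (simp add: J_mat_def G_def EE W_eq reduce)
    (simp add: vec_eq_iff field_simps power2_eq_square)

lemma invertible_J: "invertible (J_mat X D t)"
  unfolding J_mat_def A_def[symmetric]
  by (rule invertible_skew_perturbation) (simp_all add: transpose_A)

text \<open>The blocks are encoded by their action on a stacked pair. Both diagonal blocks are
  \<open>G t\<close> because \<open>X\<^sup>T E\<close> and \<open>- E\<^sup>T X\<close> both equal
  \<open>A/2\<close>.\<close>

lemma wy_M_mult_vconcat:
  "wy_M X D t ** vconcat S T =
     vconcat (G t ** S + (t/2) *\<^sub>R T) (G t ** T - (t/2) *\<^sub>R (transpose E ** E ** S))"
proof -
  have "wy_M X D t ** vconcat S T = vconcat S T + (t/2) *\<^sub>R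
          (vconcat (transpose X) (- transpose E) ** (E ** S + X ** T))"
    by (simp add: wy_M_def wy_U_def wy_V_def E_def[symmetric] matrix_add_rdistrib
        transpose_hconcat transpose_uminus hconcat_mult_vconcat
        flip: scalar_matrix_assoc matrix_mul_assoc)
  also have "\<dots> = vconcat (S + (t/2) *\<^sub>R ((1/2) *\<^sub>R A ** S + T))
      (T + (t/2) *\<^sub>R ((1/2) *\<^sub>R A ** T - transpose E ** E ** S))"
    by (simp add: vconcat_mult vconcat_scaleR vconcat_add matrix_ring_simps XE EX orth)
  also have "\<dots> = vconcat (G t ** S + (t/2) *\<^sub>R T) (G t ** T - (t/2) *\<^sub>R (transpose E ** E ** S))"
    by (simp add: G_def matrix_ring_simps vconcat_inject) (simp add: vec_eq_iff field_simps)
  finally show ?thesis .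
qed

text \<open>Multiplying the first block row by \<open>G t\<close> and subtracting \<open>t/2\<close>
  times the second cancels \<open>T\<close>.\<close>

lemma wy_M_elimination:
  assumes "wy_M X D t ** vconcat S T = vconcat P Q"
  shows "J_mat X D t ** S = G t ** P - (t/2) *\<^sub>R Q"
proof -
  have "P = G t ** S + (t/2) *\<^sub>R T" and "Q = G t ** T - (t/2) *\<^sub>R (transpose E ** E ** S)"
    using assms by (simp_all add: wy_M_mult_vconcat vconcat_inject)
  then show ?thesis
    by (simp add: J_eq matrix_ring_simps) (simp add: vec_eq_iff field_simps power2_eq_square)
qed

lemma invertible_wy_M:
  assumes "invertible (G t)"
  shows "invertible (wy_M X D t)"
proof (rule invertible_if_mult_zero)
  fix Z :: "real^('p + 'p)^('p + 'p)"
  assume *: "wy_M X D t ** Z = 0"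
  obtain S T where Z: "Z = vconcat S T" by (rule vconcat_cases)
  have MZ: "wy_M X D t ** vconcat S T = vconcat 0 0"
    using * by (simp add: Z vconcat_zero)
  have "J_mat X D t ** S = 0"
    using wy_M_elimination[OF MZ] by (simp add: matrix_mult_zero_right)
  then have S: "S = 0"
    by (metis invertible_J matrix_inv_mult_eq(2) matrix_mult_zero_right)
  \<comment> \<open>With \<open>S = 0\<close> the second block row reduces to this, and
    invertibility of \<open>G t\<close> finishes.\<close>
  have "G t ** T = 0"
    using MZ by (simp add: wy_M_mult_vconcat vconcat_inject S matrix_mult_zero_right)
  then have "T = 0"
    by (metis assms matrix_inv_mult_eq(2) matrix_mult_zero_right)
  with S Z show "Z = 0" by (simp add: vconcat_zero)
qed

lemma Y_wy_eq_Y_update: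
  assumes "invertible (wy_M X D t)"
  shows "Y_wy X D t = Y_update X D t"
proof -
  let ?J = "matrix_inv (J_mat X D t)"
  have VX: "transpose (wy_V X D) ** X = vconcat (mat 1) ((1/2) *\<^sub>R A)"
    by (simp add: wy_V_def transpose_hconcat vconcat_mult E_def[symmetric] orth EX
        transpose_uminus matrix_mult_minus_left)
  obtain S T where ST: "matrix_inv (wy_M X D t) ** (transpose (wy_V X D) ** X) = vconcat S T"
    by (rule vconcat_cases)
  have MST: "wy_M X D t ** vconcat S T = vconcat (mat 1) ((1/2) *\<^sub>R A)"
    using matrix_inv_mult_eq(1)[OF assms] ST VX by metis
  \<comment> \<open>The eliminated right-hand side is \<open>G t - (t/4) A\<close>, the
    identity.\<close>
  have "J_mat X D t ** S = mat 1"
    using wy_M_elimination[OF MST] by (simp add: G_def)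
  then have S: "S = ?J"
    by (metis invertible_J matrix_inv_mult_eq(2) matrix_mul_rid)
  have "G t ** S + (t/2) *\<^sub>R T = mat 1"
    using MST by (simp add: wy_M_mult_vconcat vconcat_inject)
  \<comment> \<open>Keeping the factor \<open>t\<close> avoids a division, so \<open>t = 0\<close>
    is covered; the update uses \<open>T\<close> only through this product.\<close>
  then have T: "t *\<^sub>R T = 2 *\<^sub>R (mat 1 - G t ** S)"
    by (simp add: vec_eq_iff field_simps)
  have "Y_wy X D t = X - t *\<^sub>R (wy_U X D ** vconcat S T)"
    by (simp add: Y_wy_def flip: ST matrix_mul_assoc)
  also have "\<dots> = X - t *\<^sub>R (E ** S) - X ** (t *\<^sub>R T)"
    by (simp add: wy_U_def E_def[symmetric] hconcat_mult_vconcat matrix_scalar_ac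
        scalar_matrix_assoc[symmetric] scaleR_add_right)
  also have "\<dots> = (2 *\<^sub>R (X ** G t) - t *\<^sub>R E) ** S - X"
    by (simp add: T matrix_ring_simps) (simp add: vec_eq_iff field_simps)
  \<comment> \<open>\<open>2 X G\<close> and \<open>- t E\<close> each contribute
    \<open>(t/2) X A\<close>; together these supply the \<open>t X A\<close> in
    \<open>t W\<close>.\<close>
  also have "2 *\<^sub>R (X ** G t) - t *\<^sub>R E = 2 *\<^sub>R X + t *\<^sub>R W_mat X D"
    by (simp add: G_def E_eq W_eq matrix_ring_simps) (simp add: vec_eq_iff field_simps)
  finally show ?thesis
    by (simp add: Y_update_def S)
qed

end

theorem proposition3p1:
  fixes X D :: "real^'p^'n" and \<tau> :: real
  assumes "CARD('p) \<le> CARD('n)"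
    and "transpose X ** X = mat 1"
    and "0 \<le> \<tau>"
    and "transpose X ** D + transpose D ** X = 0"
    and "invertible (mat 1 + (\<tau>/4) *\<^sub>R (transpose X ** D))"
  shows "invertible (wy_M X D \<tau>) \<and> invertible (J_mat X D \<tau>) \<and> Y_wy X D \<tau> = Y_update X D \<tau>"
proof -
  interpret stiefel_direction X D
    using assms(2,4) by unfold_locales
  have "invertible (wy_M X D \<tau>)"
    using assms(5) by (intro invertible_wy_M) (simp add: G_def A_def)
  then show ?thesis
    using invertible_J Y_wy_eq_Y_update by blast
qed

end
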